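(* Let $j\in\mathcal J$ and let $\theta_j\in\{d_j,\sigma_j\}$ be the free scalar parameter, all other model parameters being held fixed. Assume the local regularity condition at a reference value $\bar\theta_j$, with neighborhood $\mathcal T$ (see context). Then, for $\theta_j\in\mathcal T$, the $j$-th component $n_j^*$ of the local minimizer is locally (i) decreasing in the sampling cost: if $\theta_j=d_j$, then $\frac{\partial n_j^*}{\partial d_j}<0$; (ii) increasing in the initial demand uncertainty: if $\theta_j=\sigma_j$, then $\frac{\partial n_j^*}{\partial\sigma_j}>0$.
   Context: $\mathcal I,\mathcal J$ are finite index sets, $b>0$, $\mathcal X=\{x\in\{0,1\}^{|\mathcal I|}:\sum_{i\in\mathcal I} x_i\le p\}$, $\mathcal N=[0,b]^{|\mathcal J|}$. The objective is $$F(x,n)=e+d^\top n+r^\top x+\sum_{j\in\mathcal J}f_j(x,n_j),\qquad f_j(x,n_j)=h_j(n_j;\sigma_j)\sum_{i\in\mathcal I}q_{ij}\Psi\!\left(\frac{g_{ij}(x)}{h_j(n_j;\sigma_j)}\right),$$ with $e\in\mathbb R$, $d\in\mathbb R^{|\mathcal J|}$ (sampling costs), $r\in\mathbb R^{|\mathcal I|}$, $q_{ij}>0$, each $g_{ij}$ an affine function of $x$, and $\Psi(z)=z\Phi(z)+\phi(z)$, where $\Phi,\phi$ are the standard normal cdf and pdf. Standing assumption on the standard deviations $h_j$: (i) $h_j(\cdot;\sigma_j)$ is finite, positive, strictly convex, decreasing and continuously differentiable on $[0,\infty)$ for any $\sigma_j$; (ii) $\frac{\partial h_j}{\partial\sigma_j}(n_j;\sigma_j)>0$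 for all $n_j\ge0$; (iii) $\frac{\partial^2h_j}{\partial n_j\partial\sigma_j}(n_j;\sigma_j)<0$ for all $n_j\ge0$. A point $(x^*,n^* )\in\mathcal X\times\mathcal N$ is a (blockwise) local minimizer of $F$ if $x^*\in\arg\min_{x\in\mathcal X}F(x,n^* )$ and there is $\epsilon>0$ with $F(x^*,n^* )\le F(x^*,n)$ for all $n\in\mathcal N$ with $\|n-n^*\|<\epsilon$. Local regularity condition: for the reference value $\bar\theta_j$, $(x^*(\bar\theta_j),n^*(\bar\theta_j))$ is a local minimizer of $F$ over $\mathcal X\times\mathcal N$, and there is an open neighborhood $\mathcal T$ of $\bar\theta_j$ such that for every $\theta_j\in\mathcal T$ the corresponding local minimizer $(x^*(\theta_j),n^*(\theta_j))$ of $F$ over $\mathcal X\times\mathcal N$ satisfies $x^*(\theta_j)=x^*(\bar\theta_j)$ and $n^*(\theta_j)\in(0,b)^{|\mathcal J|}$. $\theta_j\mapsto n_j^*(\theta_j)$ denotes the resulting differentiable local solution mapping on $\mathcal T$ of the one-dimensional problem $\min_{0\le n_j\le b}\{\varphi_j(n_j;\theta_j):=d_jn_j+f_j(x,n_j)\}$ with $x=x^*(\bar\theta_j)$.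
   Formalization: It is additionally assumed that the derivative of h_j in n_j is jointly differentiable in (n_j, σ_j) for n_j > 0, and that the index set I is nonempty; without these the strict inequalities can fail. *)

theory Defs
  imports "HOL-Probability.Probability"
begin

definition Psi :: "real \<Rightarrow> real" where
  "Psi z = z * cdf std_normal_distribution z + std_normal_density z"

definition affine_fun :: "('a::real_inner \<Rightarrow> real) \<Rightarrow> bool" where
  "affine_fun g \<longleftrightarrow> (\<exists>a c. \<forall>x. g x = a \<bullet> x + c)"

definition strictly_convex_on :: "'a::real_vector set \<Rightarrow> ('a \<Rightarrow> real) \<Rightarrow> bool" where
  "strictly_convex_on S f \<longleftrightarrow>
     convex S \<and>
     (\<forall>x\<in>S. \<forall>y\<in>S. \<forall>t. x \<noteq> y \<longrightarrow> 0 < t \<longrightarrow> t < 1 \<longrightarrow>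
        f ((1 - t) *\<^sub>R x + t *\<^sub>R y) < (1 - t) * f x + t * f y)"


text \<open>
  A standard deviation function is written \<open>h n s\<close>, with sample size \<open>n \<ge> 0\<close> and
  uncertainty parameter \<open>s\<close>. Its partial derivative in \<open>n\<close> is the one-sided one at \<open>n = 0\<close>;
  values of \<open>h\<close> at negative \<open>n\<close> are irrelevant.
\<close>

definition partial_n :: "(real \<Rightarrow> real \<Rightarrow> real) \<Rightarrow> real \<Rightarrow> real \<Rightarrow> real" where
  "partial_n h n s = vector_derivative (\<lambda>m. h m s) (at n within {0..})"

text \<open>
  The standing assumption, for \<open>s\<close> in an open set \<open>S\<close> of admissible parameter values (such as
  the positive reals, or all reals). The mixed second derivative is read as the
  \<open>s\<close>-derivative of \<^const>\<open>partial_n\<close>.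
\<close>

definition sd_assumption :: "real set \<Rightarrow> (real \<Rightarrow> real \<Rightarrow> real) \<Rightarrow> bool" where
  "sd_assumption S h \<longleftrightarrow>
     open S \<and>
     (\<forall>s\<in>S.
        (\<forall>n\<ge>0. h n s > 0) \<and>
        strictly_convex_on {0..} (\<lambda>n. h n s) \<and>
        antimono_on {0..} (\<lambda>n. h n s) \<and>
        (\<lambda>n. h n s) differentiable_on {0..} \<and>
        continuous_on {0..} (\<lambda>n. partial_n h n s) \<and>
        (\<forall>n\<ge>0. (\<lambda>t. h n t) differentiable (at s) \<and> deriv (\<lambda>t. h n t) s > 0) \<and>
        (\<forall>n\<ge>0. (\<lambda>t. partial_n h n t) differentiable (at s) \<and> deriv (\<lambda>t. partial_n h n t) s < 0))"

text \<open>
  Joint differentiability of the first partial derivative in \<open>n\<close>. It is what allows the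
  first-order condition to be differentiated implicitly, and it does not follow from
  \<^const>\<open>sd_assumption\<close>, where the \<open>n\<close>-derivative is only continuous in \<open>n\<close>: with
  \<open>h\<close> equal to \<open>s\<close> times the integral from \<open>n\<close> to infinity of a positive decreasing function
  that is \<open>2 - root 3 (m - 1)\<close> for \<open>m \<le> 2\<close>, the minimizer of \<open>c * n + h n s\<close> is
  \<open>1 + (2 - c / s) ^ 3\<close>, whose derivatives in \<open>c\<close> and \<open>s\<close> vanish at \<open>c = 2\<close>, \<open>s = 1\<close>.
\<close>

definition partial_n_differentiable :: "real set \<Rightarrow> (real \<Rightarrow> real \<Rightarrow> real) \<Rightarrow> bool" where
  "partial_n_differentiable S h \<longleftrightarrow>
     (\<forall>n>0. \<forall>s\<in>S. (\<lambda>(m, t). partial_n h m t) differentiable (at (n, s)))"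


definition feasible_x :: "real \<Rightarrow> (real ^ 'i) set" where
  "feasible_x p = {x. (\<forall>i. x $ i \<in> {0, 1}) \<and> (\<Sum>i\<in>UNIV. x $ i) \<le> p}"

definition feasible_n :: "real \<Rightarrow> (real ^ 'j) set" where
  "feasible_n b = {n. \<forall>j. n $ j \<in> {0..b}}"

definition fj ::
  "('i::finite \<Rightarrow> 'j \<Rightarrow> real) \<Rightarrow> ('i \<Rightarrow> 'j \<Rightarrow> real ^ 'i \<Rightarrow> real) \<Rightarrow> ('j \<Rightarrow> real \<Rightarrow> real \<Rightarrow> real) \<Rightarrow>
   ('j \<Rightarrow> real) \<Rightarrow> 'j \<Rightarrow> real ^ 'i \<Rightarrow> real \<Rightarrow> real" where
  "fj q g h \<sigma> j x m =
     h j m (\<sigma> j) * (\<Sum>i\<in>UNIV. q i j * Psi (g i j x / h j m (\<sigma> j)))"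

definition objective ::
  "real \<Rightarrow> real ^ 'i \<Rightarrow> ('i::finite \<Rightarrow> 'j::finite \<Rightarrow> real) \<Rightarrow> ('i \<Rightarrow> 'j \<Rightarrow> real ^ 'i \<Rightarrow> real) \<Rightarrow>
   ('j \<Rightarrow> real \<Rightarrow> real \<Rightarrow> real) \<Rightarrow> real ^ 'j \<Rightarrow> ('j \<Rightarrow> real) \<Rightarrow> real ^ 'i \<Rightarrow> real ^ 'j \<Rightarrow> real" where
  "objective e r q g h d \<sigma> x n =
     e + d \<bullet> n + r \<bullet> x + (\<Sum>j\<in>UNIV. fj q g h \<sigma> j x (n $ j))"

definition local_minimizer ::
  "'a set \<Rightarrow> 'b::real_normed_vector set \<Rightarrow> ('a \<Rightarrow> 'b \<Rightarrow> real) \<Rightarrow> 'a \<Rightarrow> 'b \<Rightarrow> bool" where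
  "local_minimizer X N F x n \<longleftrightarrow>
     x \<in> X \<and> n \<in> N \<and>
     is_arg_min (\<lambda>x'. F x' n) (\<lambda>x'. x' \<in> X) x \<and>
     (\<exists>\<epsilon>>0. \<forall>n'\<in>N. norm (n' - n) < \<epsilon> \<longrightarrow> F x n \<le> F x n')"

text \<open>
  \<open>F \<theta>\<close> is the objective at parameter value \<open>\<theta>\<close>, and \<open>xs\<close>, \<open>ns\<close> select
  the local minimizer corresponding to \<open>\<theta>\<close>.
\<close>

definition local_regularity ::
  "real \<Rightarrow> real \<Rightarrow> (real \<Rightarrow> real ^ 'i \<Rightarrow> real ^ 'j \<Rightarrow> real) \<Rightarrow> real \<Rightarrow> real set \<Rightarrow>
   (real \<Rightarrow> real ^ 'i) \<Rightarrow> (real \<Rightarrow> real ^ 'j) \<Rightarrow> bool" where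
  "local_regularity p b F \<theta>ref T xs ns \<longleftrightarrow>
     open T \<and> \<theta>ref \<in> T \<and>
     local_minimizer (feasible_x p) (feasible_n b) (F \<theta>ref) (xs \<theta>ref) (ns \<theta>ref) \<and>
     (\<forall>\<theta>\<in>T.
        local_minimizer (feasible_x p) (feasible_n b) (F \<theta>) (xs \<theta>) (ns \<theta>) \<and>
        xs \<theta> = xs \<theta>ref \<and>
        (\<forall>k. ns \<theta> $ k \<in> {0<..<b}))"

definition vec_upd :: "real ^ 'j \<Rightarrow> 'j \<Rightarrow> real \<Rightarrow> real ^ 'j" where
  "vec_upd v j t = (\<chi> k. if k = j then t else v $ k)"

end

theory Submission
  imports Defs
begin

text \<open>
  Write \<open>\<phi>\<close> for the standard normal density. Since \<open>\<Psi>' = \<Phi>\<close>, the terms with \<open>\<Phi>\<close>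
  cancel when \<open>y * \<Psi> (a / y)\<close> is differentiated in \<open>y\<close>, and what remains is \<open>\<phi> (a / y)\<close>
  (\<open>scaled_Psi_has_derivative\<close>). So the \<open>n\<^sub>j\<close>-derivative of the objective is \<open>d\<^sub>j + h\<^sub>n * A (h)\<close>
  with \<open>A y = (\<Sum>i. q\<^sub>i * \<phi> (a\<^sub>i / y))\<close>, and it vanishes at a local minimizer that lies in the
  interior of the box (\<open>first_order_condition\<close>). The function \<open>A\<close> is positive, and it is
  nondecreasing on the positive reals because \<open>\<phi>\<close> decreases away from the origin.

  The selected minimizer satisfies this equation at every parameter value in \<open>T\<close>, so the
  equation can be differentiated along the solution curve. With \<open>c\<close> the cost, \<open>s\<close> the
  uncertainty and \<open>m\<close> the optimal sample size, all functions of the parameter, this gives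
  \<open>c' + K * m' = L * s'\<close>, where
  \<open>K = h\<^sub>n\<^sub>n * A h + h\<^sub>n ^ 2 * A' h\<close> and \<open>L = - (h\<^sub>n\<^sub>s * A h + h\<^sub>n * A' h * h\<^sub>s)\<close>.
  Convexity of \<open>h\<close> gives \<open>K \<ge> 0\<close>; the signs of \<open>h\<^sub>n\<close>, \<open>h\<^sub>s\<close> and \<open>h\<^sub>n\<^sub>s\<close> give \<open>L > 0\<close>
  (\<open>differentiated_first_order_condition\<close>). For \<open>c' = 1\<close>, \<open>s' = 0\<close> the equation reads
  \<open>K * m' = - 1\<close>, and for \<open>c' = 0\<close>, \<open>s' = 1\<close> it reads \<open>K * m' = L\<close>. In both cases it rules out
  \<open>K = 0\<close> by itself, so \<open>K > 0\<close>, and the sign of \<open>m'\<close> can be read off.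
\<close>

section \<open>The normal loss function\<close>

lemma std_normal_density_has_derivative:
  "(std_normal_density has_real_derivative - z * std_normal_density z) (at z)"
  unfolding normal_density_def
  by (auto intro!: derivative_eq_intros simp: field_simps power2_eq_square)

lemma cdf_std_normal_has_derivative:
  "(cdf std_normal_distribution has_real_derivative std_normal_density z) (at z)"
proof -
  interpret real_distribution std_normal_distribution by (rule real_dist_normal_dist)
  \<comment> \<open>Any base point to the left of \<open>z\<close> serves for the fundamental theorem of calculus.\<close>
  let ?c = "z - 1"
  have cont: "continuous_on A std_normal_density" for A
    by (meson DERIV_isCont continuous_at_imp_continuous_on std_normal_density_has_derivative)
  have "cdf std_normal_distribution u
      = cdf std_normal_distribution ?c + (LBINT y=?c..u. std_normal_density y)" if "u > ?c" for u
  proof -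
    have "cdf std_normal_distribution u - cdf std_normal_distribution ?c
        = measure std_normal_distribution {?c<..u}"
      using cdf_diff_eq that by blast
    also have "\<dots> = (\<integral>x. indicator {?c<..u} x \<partial>std_normal_distribution)"
      by simp
    also have "\<dots> = (LBINT y:{?c<..u}. std_normal_density y)"
      by (subst integral_density) (auto simp: set_lebesgue_integral_def mult.commute)
    also have "\<dots> = (LBINT y=?c..u. std_normal_density y)"
      using that by (simp add: interval_integral_Ioc)
    finally show ?thesis by simp
  qed
  moreover have deriv: "((\<lambda>u. cdf std_normal_distribution ?c + (LBINT y=?c..u. std_normal_density y))
      has_real_derivative std_normal_density z) (at z)"
  proof -
    have "((\<lambda>u. LBINT y=?c..u. std_normal_density y) has_vector_derivative std_normal_density z)
        (at z within {z-1..z+1})"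
      by (rule interval_integral_FTC2) (auto intro: cont)
    then have "((\<lambda>u. LBINT y=?c..u. std_normal_density y)
        has_real_derivative std_normal_density z) (at z)"
      by (simp add: has_real_derivative_iff_has_vector_derivative at_within_Icc_at)
    from DERIV_add[OF DERIV_const this] show ?thesis by simp
  qed
  moreover have "\<forall>\<^sub>F u in nhds z. u > ?c"
    using eventually_nhds_in_open[of "{?c<..}" z] by simp
  ultimately have "\<forall>\<^sub>F u in nhds z. cdf std_normal_distribution u
      = cdf std_normal_distribution ?c + (LBINT y=?c..u. std_normal_density y)"
    by (metis (mono_tags, lifting) eventually_mono)
  then show ?thesis
    using deriv by (subst DERIV_cong_ev[OF refl _ refl])
qed

text \<open>
  The density satisfies \<open>\<phi>' z = - z * \<phi> z\<close>, which cancels the term \<open>z * \<phi> z\<close> from the product rule.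
\<close>

lemma Psi_has_derivative: "(Psi has_real_derivative cdf std_normal_distribution z) (at z)"
proof -
  from DERIV_add[OF DERIV_mult[OF DERIV_ident cdf_std_normal_has_derivative]
      std_normal_density_has_derivative]
  show ?thesis
    by (simp add: Psi_def[abs_def])
qed

lemma scaled_Psi_has_derivative:
  assumes "y > 0"
  shows "((\<lambda>y. y * Psi (a / y)) has_real_derivative std_normal_density (a / y)) (at y)"
proof -
  have "((\<lambda>y. Psi (a / y)) has_real_derivative
      cdf std_normal_distribution (a / y) * (- a / y\<^sup>2)) (at y)"
    by (rule DERIV_chain2[OF Psi_has_derivative])
      (use assms in \<open>auto intro!: derivative_eq_intros simp: power2_eq_square\<close>)
  from DERIV_mult[OF DERIV_ident this] show ?thesis
    using assms by (simp add: Psi_def field_simps power2_eq_square)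
qed

text \<open>
  The slope in the standard deviation \<open>y\<close> of the weighted sum of scaled loss terms that
  makes up \<^const>\<open>fj\<close>.
\<close>

definition loss_slope :: "('i::finite \<Rightarrow> real) \<Rightarrow> ('i \<Rightarrow> real) \<Rightarrow> real \<Rightarrow> real" where
  "loss_slope q a y = (\<Sum>i\<in>UNIV. q i * std_normal_density (a i / y))"

lemma loss_has_derivative:
  fixes q a :: "'i::finite \<Rightarrow> real"
  assumes "y > 0"
  shows "((\<lambda>y. y * (\<Sum>i\<in>UNIV. q i * Psi (a i / y))) has_real_derivative loss_slope q a y) (at y)"
proof -
  have "((\<lambda>y. \<Sum>i\<in>UNIV. q i * (y * Psi (a i / y))) has_real_derivative loss_slope q a y) (at y)"
    unfolding loss_slope_def
    by (intro DERIV_sum DERIV_cmult scaled_Psi_has_derivative assms)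
  then show ?thesis
    by (simp add: sum_distrib_left mult.left_commute)
qed

lemma loss_slope_pos:
  fixes q a :: "'i::finite \<Rightarrow> real"
  assumes "\<And>i. q i > 0"
  shows "loss_slope q a y > 0"
  unfolding loss_slope_def by (intro sum_pos) (auto intro!: mult_pos_pos assms normal_density_pos)

text \<open>
  As \<open>y > 0\<close> grows, each \<open>a i / y\<close> moves towards the origin, where the density is largest.
\<close>

lemma loss_slope_has_derivative_nonneg:
  fixes q a :: "'i::finite \<Rightarrow> real"
  assumes "\<And>i. q i > 0" "y > 0"
  obtains D where "(loss_slope q a has_real_derivative D) (at y)" "D \<ge> 0"
proof
  let ?D = "\<Sum>i\<in>UNIV. q i * (- (a i / y) * std_normal_density (a i / y) * (- a i / y\<^sup>2))"
  have "((\<lambda>y. std_normal_density (a i / y)) has_real_derivative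
      - (a i / y) * std_normal_density (a i / y) * (- a i / y\<^sup>2)) (at y)" for i
    by (rule DERIV_chain2[OF std_normal_density_has_derivative])
      (use assms in \<open>auto intro!: derivative_eq_intros simp: power2_eq_square\<close>)
  then show "(loss_slope q a has_real_derivative ?D) (at y)"
    unfolding loss_slope_def[abs_def] by (intro DERIV_sum DERIV_cmult)
  have "q i * (- (a i / y) * std_normal_density (a i / y) * (- a i / y\<^sup>2)) \<ge> 0" for i
  proof -
    have "q i * (- (a i / y) * std_normal_density (a i / y) * (- a i / y\<^sup>2))
        = q i * std_normal_density (a i / y) * ((a i)\<^sup>2 / y ^ 3)"
      by (simp add: power2_eq_square power3_eq_cube mult_ac)
    also have "\<dots> \<ge> 0"
      using assms(1)[of i] assms(2) by (intro mult_nonneg_nonneg divide_nonneg_nonneg) auto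
    finally show ?thesis .
  qed
  then show "?D \<ge> 0" by (intro sum_nonneg)
qed

section \<open>The standard deviation functions\<close>

lemma sd_pos: "sd_assumption S h \<Longrightarrow> s \<in> S \<Longrightarrow> n \<ge> 0 \<Longrightarrow> h n s > 0"
  by (auto simp: sd_assumption_def)

lemma sd_has_partial_s:
  assumes "sd_assumption S h" "s \<in> S" "n \<ge> 0"
  shows "((\<lambda>t. h n t) has_real_derivative deriv (\<lambda>t. h n t) s) (at s)"
    and "deriv (\<lambda>t. h n t) s > 0"
    and "deriv (\<lambda>t. partial_n h n t) s < 0"
  using assms unfolding sd_assumption_def DERIV_deriv_iff_real_differentiable by blast+

lemma sd_has_partial_n:
  assumes "sd_assumption S h" "s \<in> S" "n > 0"
  shows "((\<lambda>m. h m s) has_real_derivative partial_n h n s) (at n)"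
proof -
  have "at n within {0..} = at n"
    using assms(3) by (intro at_within_interior) (auto simp: interior_real_atLeast)
  moreover have "(\<lambda>m. h m s) differentiable (at n within {0..})"
    using assms unfolding sd_assumption_def differentiable_on_def by auto
  ultimately show ?thesis
    unfolding partial_n_def has_real_derivative_iff_has_vector_derivative
    by (metis vector_derivative_works)
qed

lemma sd_partial_n_nonpos:
  assumes "sd_assumption S h" "s \<in> S" "n > 0"
  shows "partial_n h n s \<le> 0"
proof -
  have "antimono_on {0..} (\<lambda>m. h m s)"
    using assms by (simp add: sd_assumption_def)
  then have "mono_on {0..} (\<lambda>m. - h m s)"
    by (simp add: monotone_on_def)
  from mono_on_imp_deriv_nonneg[OF this DERIV_minus[OF sd_has_partial_n[OF assms]]]
  show ?thesis
    using assms(3) by (simp add: interior_real_atLeast)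
qed

lemma strictly_convex_on_imp_convex_on:
  assumes "strictly_convex_on S f"
  shows "convex_on S f"
proof (rule convex_onI)
  fix t :: real and x y assume "0 < t" "t < 1" "x \<in> S" "y \<in> S"
  then show "f ((1 - t) *\<^sub>R x + t *\<^sub>R y) \<le> (1 - t) * f x + t * f y"
  proof (cases "x = y")
    case True
    moreover have "(1 - t) *\<^sub>R y + t *\<^sub>R y = y"
      by (simp flip: scaleR_left_distrib)
    ultimately show ?thesis by (simp add: left_diff_distrib)
  next
    case False
    then show ?thesis
      using assms \<open>0 < t\<close> \<open>t < 1\<close> \<open>x \<in> S\<close> \<open>y \<in> S\<close>
      by (auto simp: strictly_convex_on_def intro: less_imp_le)
  qed
qed (use assms in \<open>simp add: strictly_convex_on_def\<close>)

text \<open>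
  Adding the tangent inequalities at \<open>m\<close> and at \<open>n\<close> gives
  \<open>(h\<^sub>n n - h\<^sub>n m) * (n - m) \<ge> 0\<close>.
\<close>

lemma sd_partial_n_mono:
  assumes "sd_assumption S h" "s \<in> S"
  shows "mono_on {0<..} (\<lambda>n. partial_n h n s)"
proof (rule mono_onI)
  fix m n :: real assume mn: "m \<in> {0<..}" "n \<in> {0<..}" "m \<le> n"
  have convex: "convex_on {0..} (\<lambda>n. h n s)"
    using assms by (auto simp: sd_assumption_def intro: strictly_convex_on_imp_convex_on)
  have tangent: "h y s - h x s \<ge> partial_n h x s * (y - x)" if "x > 0" "y > 0" for x y
    by (rule convex_on_imp_above_tangent[OF convex])
      (use that sd_has_partial_n[OF assms that(1)] in
        \<open>auto simp: interior_real_atLeast intro: has_field_derivative_at_within\<close>)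
  have "partial_n h m s * (n - m) \<le> partial_n h n s * (n - m)"
    using tangent[of m n] tangent[of n m] mn by (simp add: algebra_simps)
  then show "partial_n h m s \<le> partial_n h n s"
    using mn by (cases "m = n") auto
qed

text \<open>
  A partial derivative that exists in one variable and one that is continuous in the other
  give joint differentiability. The continuous one here is \<^const>\<open>partial_n\<close>.
\<close>

lemma sd_jointly_differentiable:
  assumes sd: "sd_assumption S h" and pd: "partial_n_differentiable S h"
    and "s \<in> S" "n > 0"
  shows "((\<lambda>(t, m). h m t) has_derivative
      (\<lambda>(u, v). deriv (\<lambda>t. h n t) s * u + partial_n h n s * v)) (at (s, n))"
proof -
  have "open S" using sd by (simp add: sd_assumption_def)
  have "((\<lambda>(t, m). h m t) has_derivative
      (\<lambda>(u, v). deriv (\<lambda>t. h n t) s * u + blinfun_apply (blinfun_mult_right (partial_n h n s)) v))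
      (at (s, n) within S \<times> {0<..})"
  proof (rule has_derivative_partialsI)
    have "((\<lambda>t. h n t) has_real_derivative deriv (\<lambda>t. h n t) s) (at s)"
      using sd_has_partial_s(1)[OF sd \<open>s \<in> S\<close>] \<open>n > 0\<close> by simp
    then show "((\<lambda>t. h n t) has_derivative (*) (deriv (\<lambda>t. h n t) s)) (at s within S)"
      by (auto simp: has_field_derivative_def intro: has_derivative_at_withinI)
  next
    fix t m :: real assume "t \<in> S" "m \<in> {0<..}"
    then show "((\<lambda>m. h m t) has_derivative blinfun_apply (blinfun_mult_right (partial_n h m t)))
        (at m within {0<..})"
      using sd_has_partial_n[OF sd, of t m]
      by (auto simp: has_field_derivative_def blinfun_mult_right.rep_eq
          intro: has_derivative_at_withinI)
  next
    have "(\<lambda>(m, t). partial_n h m t) differentiable (at (n, s))"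
      using pd assms(3,4) unfolding partial_n_differentiable_def by blast
    then have "isCont (\<lambda>(m, t). partial_n h m t) (n, s)"
      by (rule differentiable_imp_continuous_within)
    moreover have "isCont (\<lambda>p. (snd p, fst p)) (s, n)"
      by (intro isCont_Pair isCont_fst isCont_snd continuous_ident)
    ultimately have "isCont (\<lambda>p. (\<lambda>(m, t). partial_n h m t) (snd p, fst p)) (s, n)"
      by (intro isCont_o2[where f = "\<lambda>p. (snd p, fst p)" and g = "\<lambda>(m, t). partial_n h m t"])
        simp_all
    then have "isCont (\<lambda>p. partial_n h (snd p) (fst p)) (s, n)"
      by simp
    then have "isCont (\<lambda>p. blinfun_mult_right (partial_n h (snd p) (fst p))) (s, n)"
      by (rule bounded_linear.continuous[OF bounded_linear_blinfun_mult_right])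
    then show "continuous (at (s, n) within S \<times> {0<..})
        (\<lambda>(t, m). blinfun_mult_right (partial_n h m t))"
      unfolding case_prod_beta by (rule continuous_at_imp_continuous_at_within)
  qed (use assms in auto)
  moreover have "at (s, n) within S \<times> {0<..} = at (s, n)"
    using \<open>open S\<close> assms(3,4) by (intro at_within_open) (auto intro: open_Times)
  ultimately show ?thesis
    by (simp add: blinfun_mult_right.rep_eq)
qed

section \<open>The first-order condition\<close>

text \<open>
  A small move in coordinate \<open>j\<close> alone keeps the point in the box, and it changes the objective only
  through \<open>d $ j * m\<close> and \<^const>\<open>fj\<close> at \<open>j\<close>.
\<close>

lemma first_order_condition:
  fixes q :: "'i::finite \<Rightarrow> 'j::finite \<Rightarrow> real" and n d :: "real ^ 'j"
  assumes min: "local_minimizer X (feasible_n b) (objective e r q g h d \<sigma>) x n"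
    and int: "\<And>k. n $ k \<in> {0<..<b}"
    and sd: "sd_assumption S (h j)" "\<sigma> j \<in> S"
  shows "d $ j + partial_n (h j) (n $ j) (\<sigma> j)
      * loss_slope (\<lambda>i. q i j) (\<lambda>i. g i j x) (h j (n $ j) (\<sigma> j)) = 0"
proof -
  let ?G = "\<lambda>m. d $ j * m + fj q g h \<sigma> j x m"
  obtain \<epsilon> where \<epsilon>: "\<epsilon> > 0"
    and le: "\<And>n'. n' \<in> feasible_n b \<Longrightarrow> norm (n' - n) < \<epsilon> \<Longrightarrow>
      objective e r q g h d \<sigma> x n \<le> objective e r q g h d \<sigma> x n'"
    using min unfolding local_minimizer_def by blast
  let ?\<delta> = "min \<epsilon> (min (n $ j) (b - n $ j))"
  have separate: "objective e r q g h d \<sigma> x (vec_upd n j m) - objective e r q g h d \<sigma> x n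
      = ?G m - ?G (n $ j)" for m
  proof -
    have "d \<bullet> vec_upd n j m - d \<bullet> n = (\<Sum>k\<in>UNIV. if k = j then d $ j * (m - n $ j) else 0)"
      unfolding inner_vec_def sum_subtractf[symmetric]
      by (intro sum.cong) (auto simp: vec_upd_def algebra_simps)
    moreover have "(\<Sum>k\<in>UNIV. fj q g h \<sigma> k x (vec_upd n j m $ k)) - (\<Sum>k\<in>UNIV. fj q g h \<sigma> k x (n $ k))
        = (\<Sum>k\<in>UNIV. if k = j then fj q g h \<sigma> j x m - fj q g h \<sigma> j x (n $ j) else 0)"
      unfolding sum_subtractf[symmetric]
      by (intro sum.cong) (auto simp: vec_upd_def)
    ultimately show ?thesis
      by (simp add: objective_def algebra_simps)
  qed
  have "?G (n $ j) \<le> ?G m" if "\<bar>n $ j - m\<bar> < ?\<delta>" for m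
  proof -
    have "m \<in> {0..b}" using that by auto
    then have "vec_upd n j m \<in> feasible_n b"
      using int by (auto simp: feasible_n_def vec_upd_def less_imp_le)
    moreover have "vec_upd n j m - n = axis j (m - n $ j)"
      by (auto simp: vec_eq_iff vec_upd_def axis_def)
    then have "norm (vec_upd n j m - n) < \<epsilon>"
      using that by (simp add: norm_eq_sqrt_inner inner_axis_axis abs_minus_commute)
    ultimately have "objective e r q g h d \<sigma> x n \<le> objective e r q g h d \<sigma> x (vec_upd n j m)"
      by (rule le)
    then show ?thesis using separate[of m] by linarith
  qed
  moreover have "(?G has_real_derivative d $ j + loss_slope (\<lambda>i. q i j) (\<lambda>i. g i j x)
      (h j (n $ j) (\<sigma> j)) * partial_n (h j) (n $ j) (\<sigma> j)) (at (n $ j))"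
  proof -
    have pos: "n $ j > 0" using int by simp
    have "((\<lambda>m. fj q g h \<sigma> j x m) has_real_derivative loss_slope (\<lambda>i. q i j) (\<lambda>i. g i j x)
        (h j (n $ j) (\<sigma> j)) * partial_n (h j) (n $ j) (\<sigma> j)) (at (n $ j))"
      unfolding fj_def
      by (rule DERIV_chain2[where f = "\<lambda>y. y * (\<Sum>i\<in>UNIV. q i j * Psi (g i j x / y))",
            OF loss_has_derivative sd_has_partial_n[OF sd pos]])
        (use sd_pos[OF sd] pos in simp)
    then show ?thesis
      by (intro DERIV_add DERIV_cmult_Id)
  qed
  moreover have "?\<delta> > 0" using \<epsilon> int by auto
  ultimately show ?thesis
    using DERIV_local_min[of ?G] by (fastforce simp: mult.commute)
qed

section \<open>Differentiating the first-order condition along the solution curve\<close>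

text \<open>
  The cost \<open>c\<close> and the uncertainty \<open>s\<close> both vary with a common parameter, so that one
  equation serves for the dependence on either of them.
\<close>

lemma differentiated_first_order_condition:
  fixes q a :: "'i::finite \<Rightarrow> real"
  assumes sd: "sd_assumption S h" and pd: "partial_n_differentiable S h"
    and q: "\<And>i. q i > 0"
    and T: "open T" "\<theta> \<in> T"
    and foc: "\<And>t. t \<in> T \<Longrightarrow>
      c t + partial_n h (m t) (s t) * loss_slope q a (h (m t) (s t)) = 0"
    and m_pos: "m \<theta> > 0" and s_in: "s \<theta> \<in> S"
    and m': "(m has_real_derivative m') (at \<theta>)"
    and c': "(c has_real_derivative c') (at \<theta>)"
    and s': "(s has_real_derivative s') (at \<theta>)"
  obtains K L where "K \<ge> 0" "L > 0" "c' + K * m' = L * s'"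
proof -
  let ?A = "loss_slope q a"
  define h0 where "h0 = h (m \<theta>) (s \<theta>)"
  define hn where "hn = partial_n h (m \<theta>) (s \<theta>)"
  define hs where "hs = deriv (\<lambda>t. h (m \<theta>) t) (s \<theta>)"
  have "h0 > 0"
    unfolding h0_def using sd_pos[OF sd s_in] m_pos by simp
  then obtain A' where A': "(?A has_real_derivative A') (at h0)" "A' \<ge> 0"
    using loss_slope_has_derivative_nonneg[where q = q and a = a] q by metis
  have "hs > 0"
    unfolding hs_def using sd_has_partial_s(2)[OF sd s_in] m_pos by simp
  have "hn \<le> 0"
    unfolding hn_def by (rule sd_partial_n_nonpos[OF sd s_in m_pos])

  \<comment> \<open>The partial derivatives of \<open>partial_n h\<close> are read off its joint derivative.\<close>
  obtain D where D: "((\<lambda>(m, t). partial_n h m t) has_derivative D) (at (m \<theta>, s \<theta>))"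
    using pd m_pos s_in unfolding partial_n_differentiable_def differentiable_def by blast
  then interpret D: bounded_linear D by (rule has_derivative_bounded_linear)
  have D_eq: "D (u, v) = D (1, 0) * u + D (0, 1) * v" for u v
  proof -
    have "D (u, v) = D (u *\<^sub>R (1, 0) + v *\<^sub>R (0, 1))" by simp
    also have "\<dots> = D (1, 0) * u + D (0, 1) * v"
      unfolding D.add D.scaleR by simp
    finally show ?thesis .
  qed
  have along: "((\<lambda>t. partial_n h (f t) (k t)) has_real_derivative D (1, 0) * f' + D (0, 1) * k') (at t0)"
    if "(f has_real_derivative f') (at t0)" "(k has_real_derivative k') (at t0)"
      "f t0 = m \<theta>" "k t0 = s \<theta>" for f k f' k' t0
  proof -
    have "((\<lambda>t. (f t, k t)) has_derivative (\<lambda>u. (f' * u, k' * u))) (at t0)"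
      using that by (intro has_derivative_Pair) (simp_all add: has_field_derivative_def)
    then have "((\<lambda>t. (\<lambda>(m, t). partial_n h m t) (f t, k t)) has_derivative
        (\<lambda>u. D (f' * u, k' * u))) (at t0)"
      by (rule has_derivative_compose) (use D that in simp)
    moreover have "(\<lambda>u. D (f' * u, k' * u)) = (*) (D (1, 0) * f' + D (0, 1) * k')"
    proof
      show "D (f' * u, k' * u) = (D (1, 0) * f' + D (0, 1) * k') * u" for u
        unfolding D_eq[of "f' * u" "k' * u"] by (simp add: algebra_simps)
    qed
    ultimately show ?thesis
      by (simp add: has_field_derivative_def)
  qed
  have "D (1, 0) \<ge> 0"
  proof (rule mono_on_imp_deriv_nonneg[OF sd_partial_n_mono[OF sd s_in]])
    show "((\<lambda>n. partial_n h n (s \<theta>)) has_real_derivative D (1, 0)) (at (m \<theta>))"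
      using along[OF DERIV_ident DERIV_const] by simp
  qed (use m_pos in \<open>simp add: interior_open\<close>)
  have "D (0, 1) < 0"
  proof -
    have "((\<lambda>t. partial_n h (m \<theta>) t) has_real_derivative D (0, 1)) (at (s \<theta>))"
      using along[OF DERIV_const DERIV_ident] by simp
    then have "deriv (\<lambda>t. partial_n h (m \<theta>) t) (s \<theta>) = D (0, 1)"
      by (rule DERIV_imp_deriv)
    moreover have "deriv (\<lambda>t. partial_n h (m \<theta>) t) (s \<theta>) < 0"
      using sd_has_partial_s(3)[OF sd s_in] m_pos by simp
    ultimately show ?thesis by simp
  qed

  have "((\<lambda>t. h (m t) (s t)) has_real_derivative hs * s' + hn * m') (at \<theta>)"
  proof -
    have "((\<lambda>t. (s t, m t)) has_derivative (\<lambda>u. (s' * u, m' * u))) (at \<theta>)"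
      using m' s' by (intro has_derivative_Pair) (simp_all add: has_field_derivative_def)
    from has_derivative_compose[OF this sd_jointly_differentiable[OF sd pd s_in m_pos]]
    have "((\<lambda>t. h (m t) (s t)) has_derivative (\<lambda>u. hs * (s' * u) + hn * (m' * u))) (at \<theta>)"
      by (simp add: hs_def hn_def)
    moreover have "(\<lambda>u. hs * (s' * u) + hn * (m' * u)) = (*) (hs * s' + hn * m')"
      by (simp add: fun_eq_iff algebra_simps)
    ultimately show ?thesis
      by (simp add: has_field_derivative_def)
  qed
  then have "((\<lambda>t. ?A (h (m t) (s t))) has_real_derivative A' * (hs * s' + hn * m')) (at \<theta>)"
    by (rule DERIV_chain2[rotated]) (use A'(1) in \<open>simp add: h0_def\<close>)
  from DERIV_add[OF c' DERIV_mult[OF along[OF m' s' refl refl] this]]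
  have "((\<lambda>t. c t + partial_n h (m t) (s t) * ?A (h (m t) (s t))) has_real_derivative
      c' + ((D (1, 0) * m' + D (0, 1) * s') * ?A h0 + A' * (hs * s' + hn * m') * hn)) (at \<theta>)"
    by (simp add: h0_def hn_def)
  moreover have "((\<lambda>t. c t + partial_n h (m t) (s t) * ?A (h (m t) (s t)))
      has_real_derivative 0) (at \<theta>)"
    by (rule has_field_derivative_transform_within_open[OF DERIV_const T]) (simp add: foc)
  ultimately have zero:
    "c' + ((D (1, 0) * m' + D (0, 1) * s') * ?A h0 + A' * (hs * s' + hn * m') * hn) = 0"
    by (rule DERIV_unique)

  have "?A h0 > 0" by (rule loss_slope_pos[OF q])
  show ?thesis
  proof
    show "D (1, 0) * ?A h0 + A' * hn\<^sup>2 \<ge> 0"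
      using \<open>D (1, 0) \<ge> 0\<close> \<open>?A h0 > 0\<close> A'(2) by simp
    have "D (0, 1) * ?A h0 < 0"
      using \<open>D (0, 1) < 0\<close> \<open>?A h0 > 0\<close> by (rule mult_neg_pos)
    moreover have "A' * hs * hn \<le> 0"
      using A'(2) \<open>hs > 0\<close> \<open>hn \<le> 0\<close> by (intro mult_nonneg_nonpos mult_nonneg_nonneg) auto
    ultimately show "- (D (0, 1) * ?A h0 + A' * hs * hn) > 0" by simp
    show "c' + (D (1, 0) * ?A h0 + A' * hn\<^sup>2) * m' = - (D (0, 1) * ?A h0 + A' * hs * hn) * s'"
      using zero by (simp add: algebra_simps power2_eq_square)
  qed
qed

section \<open>Comparative statics\<close>

theorem theorem1:
  fixes e p b \<theta>ref :: real
    and r :: "real ^ 'i"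
    and d :: "real ^ 'j"
    and q :: "'i::finite \<Rightarrow> 'j::finite \<Rightarrow> real"
    and g :: "'i \<Rightarrow> 'j \<Rightarrow> real ^ 'i \<Rightarrow> real"
    and h :: "'j \<Rightarrow> real \<Rightarrow> real \<Rightarrow> real"
    and \<sigma> :: "'j \<Rightarrow> real"
    and S :: "'j \<Rightarrow> real set"
    and j :: 'j
    and T :: "real set"
    and xs :: "real \<Rightarrow> real ^ 'i"
    and ns :: "real \<Rightarrow> real ^ 'j"
  assumes "b > 0"
    and "\<And>i k. q i k > 0"
    and "\<And>i k. affine_fun (g i k)"
    and "\<And>k. sd_assumption (S k) (h k)"
    and "\<And>k. \<sigma> k \<in> S k"
    and "partial_n_differentiable (S j) (h j)"
    and "\<And>\<theta>. \<theta> \<in> T \<Longrightarrow> (\<lambda>t. ns t $ j) differentiable (at \<theta>)"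
  shows "(local_regularity p b (\<lambda>\<theta>. objective e r q g h (vec_upd d j \<theta>) \<sigma>) \<theta>ref T xs ns \<longrightarrow>
            (\<forall>\<theta>\<in>T. deriv (\<lambda>t. ns t $ j) \<theta> < 0)) \<and>
         (T \<subseteq> S j \<and>
          local_regularity p b (\<lambda>\<theta>. objective e r q g h d (\<sigma>(j := \<theta>))) \<theta>ref T xs ns \<longrightarrow>
            (\<forall>\<theta>\<in>T. deriv (\<lambda>t. ns t $ j) \<theta> > 0))"
proof (intro conjI impI ballI)
  fix \<theta>
  assume reg: "local_regularity p b (\<lambda>\<theta>. objective e r q g h (vec_upd d j \<theta>) \<sigma>) \<theta>ref T xs ns"
    and \<theta>: "\<theta> \<in> T"
  let ?a = "\<lambda>i. g i j (xs \<theta>ref)"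
  have foc: "t + partial_n (h j) (ns t $ j) (\<sigma> j)
      * loss_slope (\<lambda>i. q i j) ?a (h j (ns t $ j) (\<sigma> j)) = 0" if "t \<in> T" for t
  proof -
    have "local_minimizer (feasible_x p) (feasible_n b)
        (objective e r q g h (vec_upd d j t) \<sigma>) (xs \<theta>ref) (ns t)"
      and int: "\<And>k. ns t $ k \<in> {0<..<b}"
      using reg that unfolding local_regularity_def by metis+
    from first_order_condition[OF this assms(4)[of j] assms(5)[of j]] show ?thesis
      by (simp add: vec_upd_def)
  qed
  have T: "open T" and pos: "ns \<theta> $ j > 0"
    using reg \<theta> unfolding local_regularity_def by auto
  have der: "((\<lambda>t. ns t $ j) has_real_derivative deriv (\<lambda>t. ns t $ j) \<theta>) (at \<theta>)"
    using assms(7)[OF \<theta>] by (simp add: DERIV_deriv_iff_real_differentiable)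
  obtain K L where "K \<ge> 0" "1 + K * deriv (\<lambda>t. ns t $ j) \<theta> = L * 0"
    by (rule differentiated_first_order_condition[OF assms(4,6,2) T \<theta> foc pos assms(5) der
          DERIV_ident DERIV_const])
  then show "deriv (\<lambda>t. ns t $ j) \<theta> < 0"
    using mult_nonneg_nonneg[of K "deriv (\<lambda>t. ns t $ j) \<theta>"] by linarith
next
  fix \<theta>
  assume "T \<subseteq> S j \<and>
      local_regularity p b (\<lambda>\<theta>. objective e r q g h d (\<sigma>(j := \<theta>))) \<theta>ref T xs ns"
    and \<theta>: "\<theta> \<in> T"
  then have T: "T \<subseteq> S j"
    and reg: "local_regularity p b (\<lambda>\<theta>. objective e r q g h d (\<sigma>(j := \<theta>))) \<theta>ref T xs ns"
    by auto
  let ?a = "\<lambda>i. g i j (xs \<theta>ref)"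
  have foc: "d $ j + partial_n (h j) (ns t $ j) t
      * loss_slope (\<lambda>i. q i j) ?a (h j (ns t $ j) t) = 0" if "t \<in> T" for t
  proof -
    have "local_minimizer (feasible_x p) (feasible_n b)
        (objective e r q g h d (\<sigma>(j := t))) (xs \<theta>ref) (ns t)"
      and int: "\<And>k. ns t $ k \<in> {0<..<b}"
      using reg that unfolding local_regularity_def by metis+
    from first_order_condition[OF this assms(4)[of j]] show ?thesis
      using T that by auto
  qed
  have "open T" and pos: "ns \<theta> $ j > 0" and "\<theta> \<in> S j"
    using reg \<theta> T unfolding local_regularity_def by auto
  have der: "((\<lambda>t. ns t $ j) has_real_derivative deriv (\<lambda>t. ns t $ j) \<theta>) (at \<theta>)"
    using assms(7)[OF \<theta>] by (simp add: DERIV_deriv_iff_real_differentiable)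
  obtain K L where "K \<ge> 0" "L > 0" "0 + K * deriv (\<lambda>t. ns t $ j) \<theta> = L * 1"
    by (rule differentiated_first_order_condition[OF assms(4,6,2) \<open>open T\<close> \<theta> foc pos
          \<open>\<theta> \<in> S j\<close> der DERIV_const DERIV_ident])
  then show "deriv (\<lambda>t. ns t $ j) \<theta> > 0"
    using mult_nonneg_nonpos[of K "deriv (\<lambda>t. ns t $ j) \<theta>"] by linarith
qed

end
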